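(* Let $X$ be a Tychonoff space. Every maximal clique in $\Gamma(C_{+}(X))$ can be expressed as a union of intersections of maximal ideals of $C_{+}(X)$; that is, for every maximal clique $M$ in $\Gamma(C_{+}(X))$ there is a family $(\mathcal{A}_i)_{i\in I}$ of nonempty sets of maximal ideals of the semiring $C_{+}(X)$ such that $M=\bigcup_{i\in I}\bigcap_{N\in\mathcal{A}_i}N$.
   Context: For a Tychonoff space $X$, $C_{+}(X)$ is the commutative semiring of non-negative real-valued continuous functions on $X$ with pointwise operations. An ideal of a commutative semiring $S$ is a nonempty subset $I$ with $a+b\in I$ and $as\in I$ for all $a,b\in I$, $s\in S$; a maximal ideal is a proper ideal not contained in any other proper ideal. For $f\in C_{+}(X)$, $Z(f)=\{x\in X: f(x)=0\}$, and $\mathcal{N}'(X)$ is the set of non-units of $C_{+}(X)$ (functions with $Z(f)\neq\emptyset$). The zero-set intersection graph $\Gamma(C_{+}(X))$ has vertex set $\mathcal{N}'(X)$, with distinct vertices $f,g$ adjacent iff $Z(f)\cap Z(g)\neq\emptyset$. A clique is a nonempty set of vertices any two distinct members of which are adjacent; a maximal clique is a clique maximal with respect to inclusion. *)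

theory Defs
  imports "HOL-Analysis.Analysis" "HOL-Algebra.Ring" "HOL-Library.Ramsey"
begin

definition Tychonoff_space :: "'a topology \<Rightarrow> bool" where
  "Tychonoff_space X \<longleftrightarrow> completely_regular_space X \<and> Hausdorff_space X"

text \<open>A function on the space is represented by its extensional version (arbitrary but fixed
  value outside of \<^term>\<open>topspace X\<close>), so that equality of elements of the carrier is
  equality of functions on the space.\<close>

definition C_plus :: "'a topology \<Rightarrow> ('a \<Rightarrow> real) ring" where
  "C_plus X =
    \<lparr> carrier = {f \<in> extensional (topspace X).
                    continuous_map X euclideanreal f \<and> (\<forall>x\<in>topspace X. 0 \<le> f x)},
      mult = (\<lambda>f g. \<lambda>x\<in>topspace X. f x * g x),
      one = (\<lambda>x\<in>topspace X. 1),
      zero = (\<lambda>x\<in>topspace X. 0),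
      add = (\<lambda>f g. \<lambda>x\<in>topspace X. f x + g x) \<rparr>"

text \<open>Ideals of a commutative semiring; the ideals of HOL-Algebra require a ring.\<close>

definition semiring_ideal :: "('a, 'm) ring_scheme \<Rightarrow> 'a set \<Rightarrow> bool" where
  "semiring_ideal S I \<longleftrightarrow> I \<noteq> {} \<and> I \<subseteq> carrier S \<and>
     (\<forall>a\<in>I. \<forall>b\<in>I. a \<oplus>\<^bsub>S\<^esub> b \<in> I) \<and> (\<forall>a\<in>I. \<forall>s\<in>carrier S. a \<otimes>\<^bsub>S\<^esub> s \<in> I)"

definition proper_semiring_ideal :: "('a, 'm) ring_scheme \<Rightarrow> 'a set \<Rightarrow> bool" where
  "proper_semiring_ideal S I \<longleftrightarrow> semiring_ideal S I \<and> I \<noteq> carrier S"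

definition maximal_semiring_ideal :: "('a, 'm) ring_scheme \<Rightarrow> 'a set \<Rightarrow> bool" where
  "maximal_semiring_ideal S I \<longleftrightarrow> proper_semiring_ideal S I \<and>
     (\<forall>J. proper_semiring_ideal S J \<and> I \<subseteq> J \<longrightarrow> J = I)"

definition zero_set :: "'a topology \<Rightarrow> ('a \<Rightarrow> real) \<Rightarrow> 'a set" where
  "zero_set X f = {x \<in> topspace X. f x = 0}"

definition nonunits :: "'a topology \<Rightarrow> ('a \<Rightarrow> real) set" where
  "nonunits X = carrier (C_plus X) - Units (C_plus X)"

text \<open>The edges of the zero-set intersection graph, as two-element sets of vertices; its vertex
  set is \<^term>\<open>nonunits X\<close>.\<close>

definition zero_set_edges :: "'a topology \<Rightarrow> ('a \<Rightarrow> real) set set" where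
  "zero_set_edges X = {{f, g} | f g. f \<in> nonunits X \<and> g \<in> nonunits X \<and> f \<noteq> g \<and>
                                   zero_set X f \<inter> zero_set X g \<noteq> {}}"

definition clique_in :: "'v set \<Rightarrow> 'v set set \<Rightarrow> 'v set \<Rightarrow> bool" where
  "clique_in V E K \<longleftrightarrow> K \<noteq> {} \<and> K \<subseteq> V \<and> clique K E"

definition maximal_clique_in :: "'v set \<Rightarrow> 'v set set \<Rightarrow> 'v set \<Rightarrow> bool" where
  "maximal_clique_in V E M \<longleftrightarrow> clique_in V E M \<and>
     (\<forall>K. clique_in V E K \<and> M \<subseteq> K \<longrightarrow> K = M)"

lemma C_plus_add_closed:
  "f \<in> carrier (C_plus X) \<Longrightarrow> g \<in> carrier (C_plus X) \<Longrightarrow> f \<oplus>\<^bsub>C_plus X\<^esub> g \<in> carrier (C_plus X)"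
  by (auto simp: C_plus_def intro: continuous_map_eq[OF continuous_map_add])

lemma C_plus_mult_closed:
  "f \<in> carrier (C_plus X) \<Longrightarrow> g \<in> carrier (C_plus X) \<Longrightarrow> f \<otimes>\<^bsub>C_plus X\<^esub> g \<in> carrier (C_plus X)"
  by (auto simp: C_plus_def intro: continuous_map_eq[OF continuous_map_real_mult])

lemma C_plus_const_closed:
  "\<zero>\<^bsub>C_plus X\<^esub> \<in> carrier (C_plus X)" "\<one>\<^bsub>C_plus X\<^esub> \<in> carrier (C_plus X)"
proof -
  have "continuous_map X euclideanreal (\<lambda>x\<in>topspace X. c)" for c :: real
    by (rule continuous_map_eq[where f = "\<lambda>x. c"]) auto
  then show "\<zero>\<^bsub>C_plus X\<^esub> \<in> carrier (C_plus X)" "\<one>\<^bsub>C_plus X\<^esub> \<in> carrier (C_plus X)"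
    by (auto simp: C_plus_def)
qed

lemma C_plus_eqI:
  assumes "f \<in> carrier (C_plus X)" "g \<in> carrier (C_plus X)"
    and "\<And>x. x \<in> topspace X \<Longrightarrow> f x = g x"
  shows "f = g"
  using assms by (auto simp: C_plus_def intro: extensionalityI)

lemma C_plus_apply:
  assumes "x \<in> topspace X"
  shows "(f \<oplus>\<^bsub>C_plus X\<^esub> g) x = f x + g x" "(f \<otimes>\<^bsub>C_plus X\<^esub> g) x = f x * g x"
    "\<zero>\<^bsub>C_plus X\<^esub> x = 0" "\<one>\<^bsub>C_plus X\<^esub> x = 1"
  using assms by (simp_all add: C_plus_def)

lemmas C_plus_closed = C_plus_add_closed C_plus_mult_closed C_plus_const_closed

lemma semiring_C_plus: "semiring (C_plus X)"
proof (intro semiring.intro abelian_monoid.intro comm_monoidI monoidI semiring_axioms.intro)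
qed (simp_all add: C_plus_closed, (rule C_plus_eqI[where X = X],
       simp_all add: C_plus_closed C_plus_apply algebra_simps)+)

lemma comm_monoid_C_plus: "comm_monoid (C_plus X)"
proof -
  interpret semiring "C_plus X" by (rule semiring_C_plus)
  show ?thesis
    by (intro comm_monoid.intro comm_monoid_axioms.intro monoid_axioms)
       (rule C_plus_eqI[where X = X], simp_all add: C_plus_closed C_plus_apply algebra_simps)
qed

lemma nonunits_eq: "nonunits X = {f \<in> carrier (C_plus X). zero_set X f \<noteq> {}}"
proof -
  have "f \<in> Units (C_plus X) \<longleftrightarrow> zero_set X f = {}" if f: "f \<in> carrier (C_plus X)" for f
  proof
    assume "f \<in> Units (C_plus X)"
    then obtain g where g: "g \<otimes>\<^bsub>C_plus X\<^esub> f = \<one>\<^bsub>C_plus X\<^esub>"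
      unfolding Units_def by blast
    then have "g x * f x = 1" if "x \<in> topspace X" for x
      using that by (metis C_plus_apply(2,4))
    then show "zero_set X f = {}"
      by (force simp: zero_set_def)
  next
    assume Z: "zero_set X f = {}"
    let ?g = "\<lambda>x\<in>topspace X. inverse (f x)"
    have "continuous_map X euclideanreal (\<lambda>x. inverse (f x))"
      using f Z by (intro continuous_map_real_inverse) (auto simp: C_plus_def zero_set_def)
    then have "continuous_map X euclideanreal ?g"
      by (rule continuous_map_eq) auto
    then have "?g \<in> carrier (C_plus X)"
      using f by (auto simp: C_plus_def)
    moreover have "?g \<otimes>\<^bsub>C_plus X\<^esub> f = \<one>\<^bsub>C_plus X\<^esub>" "f \<otimes>\<^bsub>C_plus X\<^esub> ?g = \<one>\<^bsub>C_plus X\<^esub>"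
      using f Z \<open>?g \<in> carrier (C_plus X)\<close>
      by (auto intro!: C_plus_eqI[where X = X] C_plus_closed
            simp: C_plus_apply zero_set_def )
    ultimately show "f \<in> Units (C_plus X)"
      using f unfolding Units_def by blast
  qed
  then show ?thesis
    by (auto simp: nonunits_def)
qed

end

theory Submission
  imports Defs
begin

text \<open>The functions vanishing at a point \<open>x\<close> form a maximal ideal \<open>N\<^sub>x\<close>. If \<open>f\<close> lies in a maximal
  clique \<open>M\<close>, then every \<open>g\<close> in the intersection of the \<open>N\<^sub>x\<close> with \<open>x\<close> in the zero set of \<open>f\<close>
  has a zero set containing that of \<open>f\<close>, so \<open>g\<close> meets every member of \<open>M\<close> and belongs to \<open>M\<close> by
  maximality. Hence \<open>M\<close> is the union of these intersections over \<open>f \<in> M\<close>.\<close>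

definition fixed_ideal :: "'a topology \<Rightarrow> 'a \<Rightarrow> ('a \<Rightarrow> real) set" where
  "fixed_ideal X x = {f \<in> carrier (C_plus X). f x = 0}"

lemma proper_semiring_ideal_fixed:
  assumes "x \<in> topspace X"
  shows "proper_semiring_ideal (C_plus X) (fixed_ideal X x)"
proof -
  have "\<zero>\<^bsub>C_plus X\<^esub> \<in> fixed_ideal X x" "\<one>\<^bsub>C_plus X\<^esub> \<notin> fixed_ideal X x"
    using assms by (simp_all add: fixed_ideal_def C_plus_closed C_plus_apply)
  then have "fixed_ideal X x \<noteq> {}" "fixed_ideal X x \<noteq> carrier (C_plus X)"
    using C_plus_const_closed(2)[of X] by blast+
  with assms show ?thesis
    by (auto simp: proper_semiring_ideal_def semiring_ideal_def fixed_ideal_def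
          C_plus_closed C_plus_apply)
qed

text \<open>If an ideal contains a unit \<open>u\<close>, it contains \<open>u\<close> times its
  inverse, which is the one, and then every \<open>s\<close> as the product of one and
  \<open>s\<close>.\<close>

lemma proper_semiring_ideal_subset_nonunits:
  assumes "proper_semiring_ideal (C_plus X) J"
  shows "J \<subseteq> nonunits X"
proof
  fix u assume "u \<in> J"
  interpret semiring "C_plus X" by (rule semiring_C_plus)
  have J: "J \<subseteq> carrier (C_plus X)" "J \<noteq> carrier (C_plus X)"
    and mult: "\<And>a s. a \<in> J \<Longrightarrow> s \<in> carrier (C_plus X) \<Longrightarrow> a \<otimes>\<^bsub>C_plus X\<^esub> s \<in> J"
    using assms by (auto simp: proper_semiring_ideal_def semiring_ideal_def)
  have "u \<notin> Units (C_plus X)"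
  proof
    assume "u \<in> Units (C_plus X)"
    then have "\<one>\<^bsub>C_plus X\<^esub> \<in> J"
      using mult[OF \<open>u \<in> J\<close> Units_inv_closed[of u]] by simp
    then have "carrier (C_plus X) \<subseteq> J"
      using mult[of "\<one>\<^bsub>C_plus X\<^esub>"] by fastforce
    with J show False by blast
  qed
  with \<open>u \<in> J\<close> J show "u \<in> nonunits X"
    by (auto simp: nonunits_def)
qed

text \<open>In a semiring without subtraction, \<open>\<bar>g x - g\<bar>\<close> takes the place of
  \<open>g - g x\<close>: it is non-negative, continuous and zero at \<open>x\<close>, so it lies in
  every ideal \<open>J\<close> containing \<open>fixed_ideal X x\<close>. If some \<open>g\<close>
  in \<open>J\<close> had \<open>g x \<noteq> 0\<close>, adding this function to \<open>g\<close>
  would give a unit in \<open>J\<close>.\<close>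

lemma maximal_semiring_ideal_fixed:
  assumes x: "x \<in> topspace X"
  shows "maximal_semiring_ideal (C_plus X) (fixed_ideal X x)"
  unfolding maximal_semiring_ideal_def
proof (intro conjI allI impI)
  show "proper_semiring_ideal (C_plus X) (fixed_ideal X x)"
    using x by (rule proper_semiring_ideal_fixed)
  fix J assume J: "proper_semiring_ideal (C_plus X) J \<and> fixed_ideal X x \<subseteq> J"
  have "g x = 0" if "g \<in> J" for g
  proof (rule ccontr)
    assume "g x \<noteq> 0"
    have g: "g \<in> carrier (C_plus X)"
      using J that by (auto simp: proper_semiring_ideal_def semiring_ideal_def)
    text \<open>\<open>g + h \<ge> g x > 0\<close>, so \<open>g + h\<close> is a unit.\<close>
    define h where "h = (\<lambda>y\<in>topspace X. \<bar>g x - g y\<bar>)"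
    have "continuous_map X euclideanreal (\<lambda>y. \<bar>g x - g y\<bar>)"
      using g by (intro continuous_map_real_abs continuous_map_diff) (auto simp: C_plus_def)
    then have "continuous_map X euclideanreal h"
      by (rule continuous_map_eq) (simp add: h_def)
    then have "h \<in> carrier (C_plus X)"
      by (auto simp: C_plus_def h_def)
    then have "h \<in> J"
      using J x by (auto simp: fixed_ideal_def h_def)
    then have "g \<oplus>\<^bsub>C_plus X\<^esub> h \<in> J"
      using J that by (auto simp: proper_semiring_ideal_def semiring_ideal_def)
    then have "zero_set X (g \<oplus>\<^bsub>C_plus X\<^esub> h) \<noteq> {}"
      using J proper_semiring_ideal_subset_nonunits unfolding nonunits_eq by blast
    then obtain y where "y \<in> topspace X" "g y + \<bar>g x - g y\<bar> = 0"
      by (auto simp: zero_set_def C_plus_apply h_def)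
    moreover have "g x \<ge> 0"
      using g x by (auto simp: C_plus_def)
    ultimately show False
      using \<open>g x \<noteq> 0\<close> by linarith
  qed
  with J show "J = fixed_ideal X x"
    by (auto simp: fixed_ideal_def proper_semiring_ideal_def semiring_ideal_def)
qed

text \<open>Edges join distinct vertices only, but the condition extends to \<open>f = g\<close>:
  there it says that \<open>zero_set X f\<close> is nonempty, which holds for every non-unit. Later
  arguments thus avoid a case split on equality.\<close>

lemma clique_in_zero_set_edges_iff:
  "clique_in (nonunits X) (zero_set_edges X) K \<longleftrightarrow>
     K \<noteq> {} \<and> K \<subseteq> nonunits X \<and> (\<forall>f\<in>K. \<forall>g\<in>K. zero_set X f \<inter> zero_set X g \<noteq> {})"
    (is "?L \<longleftrightarrow> ?R")
proof
  assume L: ?L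
  have "zero_set X f \<inter> zero_set X g \<noteq> {}" if "f \<in> K" "g \<in> K" for f g
  proof (cases "f = g")
    case True
    then show ?thesis
      using L that by (auto simp: clique_in_def nonunits_eq)
  next
    case False
    then have "{f, g} \<in> zero_set_edges X"
      using L that by (auto simp: clique_in_def clique_def)
    then show ?thesis
      by (auto simp: zero_set_edges_def doubleton_eq_iff)
  qed
  with L show ?R
    by (auto simp: clique_in_def)
next
  assume R: ?R
  have "{f, g} \<in> zero_set_edges X" if "f \<in> K" "g \<in> K" "f \<noteq> g" for f g
    unfolding zero_set_edges_def using R that by (intro CollectI exI[of _ f] exI[of _ g]) auto
  with R show ?L
    by (simp add: clique_in_def clique_def)
qed

text \<open>For \<open>h\<close> in \<open>M\<close>, the zero sets of \<open>f\<close> and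
  \<open>h\<close> meet, hence so do those of \<open>g\<close> and \<open>h\<close>. So
  \<open>insert g M\<close> is again a clique, and maximality puts \<open>g\<close> into
  \<open>M\<close>.\<close>

lemma maximal_clique_zero_set_mono:
  assumes M: "maximal_clique_in (nonunits X) (zero_set_edges X) M"
    and "f \<in> M" "g \<in> carrier (C_plus X)" "zero_set X f \<subseteq> zero_set X g"
  shows "g \<in> M"
proof -
  have K: "M \<subseteq> nonunits X" "\<And>h k. h \<in> M \<Longrightarrow> k \<in> M \<Longrightarrow> zero_set X h \<inter> zero_set X k \<noteq> {}"
    using M by (auto simp: maximal_clique_in_def clique_in_zero_set_edges_iff)
  have meet: "zero_set X g \<inter> zero_set X h \<noteq> {}" if "h \<in> M" for h
    using K(2)[OF \<open>f \<in> M\<close> that] assms(4) by blast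
  \<comment> \<open>Taking \<open>h = f\<close> in \<open>meet\<close> makes \<open>g\<close> a
    non-unit, hence a vertex.\<close>
  then have "zero_set X g \<noteq> {}"
    using \<open>f \<in> M\<close> by blast
  then have "clique_in (nonunits X) (zero_set_edges X) (insert g M)"
    unfolding clique_in_zero_set_edges_iff
    using K meet assms(3) by (auto simp: nonunits_eq Int_commute)
  then show ?thesis
    using M unfolding maximal_clique_in_def by blast
qed

theorem theorem3p11:
  fixes X :: "'a topology" and M :: "('a \<Rightarrow> real) set"
  assumes "Tychonoff_space X"
    and "maximal_clique_in (nonunits X) (zero_set_edges X) M"
  shows "\<exists>\<A> :: ('a \<Rightarrow> real) set set set.
           (\<forall>A\<in>\<A>. A \<noteq> {} \<and> (\<forall>N\<in>A. maximal_semiring_ideal (C_plus X) N)) \<and>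
           M = (\<Union>A\<in>\<A>. \<Inter>N\<in>A. N)"
proof (intro exI conjI ballI)
  let ?\<A> = "(\<lambda>f. fixed_ideal X ` zero_set X f) ` M"
  have M: "f \<in> carrier (C_plus X)" "zero_set X f \<noteq> {}" if "f \<in> M" for f
    using assms(2) that
    by (auto simp: maximal_clique_in_def clique_in_def nonunits_eq)
  show "A \<noteq> {}" if "A \<in> ?\<A>" for A
    using that M(2) by blast
  show "maximal_semiring_ideal (C_plus X) N" if "A \<in> ?\<A>" "N \<in> A" for A N
    using that maximal_semiring_ideal_fixed by (fastforce simp: zero_set_def)
  show "M = (\<Union>A\<in>?\<A>. \<Inter>N\<in>A. N)"
  proof (intro equalityI subsetI)
    fix f assume "f \<in> M"
    then show "f \<in> (\<Union>A\<in>?\<A>. \<Inter>N\<in>A. N)"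
      using M(1) by (auto simp: fixed_ideal_def zero_set_def)
  next
    fix g assume "g \<in> (\<Union>A\<in>?\<A>. \<Inter>N\<in>A. N)"
    then obtain f where f: "f \<in> M" and g: "\<And>x. x \<in> zero_set X f \<Longrightarrow> g \<in> fixed_ideal X x"
      by auto
    \<comment> \<open>Since \<open>zero_set X f\<close> is nonempty, \<open>g\<close> lies in at
      least one \<open>fixed_ideal\<close>, and this is what puts it in the carrier.\<close>
    have "g \<in> carrier (C_plus X)" "zero_set X f \<subseteq> zero_set X g"
      using g M(2)[OF f] by (auto simp: fixed_ideal_def zero_set_def)
    then show "g \<in> M"
      using assms(2) f maximal_clique_zero_set_mono by blast
  qed
qed

end
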